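(* For any fixed finite simple graph $L$ with at least one edge, $$DC(L)=\frac{1}{\chi(L)-1},$$ where $\chi(L)$ denotes the chromatic number of $L$.
   Context: All graphs are finite and simple. For two graphs $G,G'$ on the vertex set $[n]=\{1,\dots,n\}$, $G\oplus G'$ denotes the graph on $[n]$ whose edge set is the symmetric difference of $E(G)$ and $E(G')$. For a fixed graph $L$, $M_L(n)$ denotes the maximum possible size of a family of (labeled) graphs on vertex set $[n]$ such that for any two distinct members $G,G'$ of the family, $G\oplus G'$ contains a (not necessarily induced) subgraph isomorphic to $L$. The distance capacity of $L$ is $$DC(L):=\lim_{n\to\infty}\frac{2}{n(n-1)}\log_2 M_L(n),$$ where the limit is known to exist. *)

theory Defs
  imports Complex_Main
begin

datatype 'a ugraph = UGraph (vertices: "'a set") (edges: "'a set set")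

definition simple_graph :: "'a ugraph \<Rightarrow> bool" where
  "simple_graph G \<longleftrightarrow>
     finite (vertices G) \<and> edges G \<subseteq> {e. e \<subseteq> vertices G \<and> card e = 2}"

definition subgraph_of :: "'a ugraph \<Rightarrow> 'a ugraph \<Rightarrow> bool" where
  "subgraph_of H G \<longleftrightarrow>
     simple_graph H \<and> vertices H \<subseteq> vertices G \<and> edges H \<subseteq> edges G"

definition isomorphic_graphs :: "'a ugraph \<Rightarrow> 'b ugraph \<Rightarrow> bool" where
  "isomorphic_graphs G H \<longleftrightarrow>
     (\<exists>f. bij_betw f (vertices G) (vertices H) \<and>
          (\<forall>u\<in>vertices G. \<forall>v\<in>vertices G. {u, v} \<in> edges G \<longleftrightarrow> {f u, f v} \<in> edges H))"

definition contains_copy :: "'b ugraph \<Rightarrow> 'a ugraph \<Rightarrow> bool" where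
  "contains_copy G L \<longleftrightarrow> (\<exists>H. subgraph_of H G \<and> isomorphic_graphs L H)"

definition colourable :: "'a ugraph \<Rightarrow> nat \<Rightarrow> bool" where
  "colourable G k \<longleftrightarrow>
     (\<exists>c :: 'a \<Rightarrow> nat. c ` vertices G \<subseteq> {..<k} \<and>
        (\<forall>u v. {u, v} \<in> edges G \<longrightarrow> c u \<noteq> c v))"

definition chromatic_number :: "'a ugraph \<Rightarrow> nat" where
  "chromatic_number G = (LEAST k. colourable G k)"

definition graphs_on :: "nat \<Rightarrow> nat ugraph set" where
  "graphs_on n = {G. simple_graph G \<and> vertices G = {1..n}}"

text \<open>Only applied to graphs with the same vertex set, where the union is that vertex set.\<close>

definition graph_sym_diff :: "'a ugraph \<Rightarrow> 'a ugraph \<Rightarrow> 'a ugraph" where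
  "graph_sym_diff G G' =
     UGraph (vertices G \<union> vertices G') (sym_diff (edges G) (edges G'))"

definition difference_family :: "'a ugraph \<Rightarrow> nat \<Rightarrow> nat ugraph set \<Rightarrow> bool" where
  "difference_family L n F \<longleftrightarrow>
     F \<subseteq> graphs_on n \<and>
     (\<forall>G\<in>F. \<forall>G'\<in>F. G \<noteq> G' \<longrightarrow> contains_copy (graph_sym_diff G G') L)"

text \<open>The maximum is over a finite nonempty set: there are finitely many graphs on
  \<open>{1..n}\<close>, and every family with at most one member qualifies. In particular it is at
  least 1.\<close>

definition max_family_size :: "'a ugraph \<Rightarrow> nat \<Rightarrow> nat" where
  "max_family_size L n = Max (card ` {F. difference_family L n F})"

definition distance_rate :: "'a ugraph \<Rightarrow> nat \<Rightarrow> real" where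
  "distance_rate L n = 2 / (real n * (real n - 1)) * log 2 (real (max_family_size L n))"

definition distance_capacity :: "'a ugraph \<Rightarrow> real" where
  "distance_capacity L = lim (distance_rate L)"

end

theory Submission
  imports Defs "HOL-Library.FuncSet" "HOL-Real_Asymp.Real_Asymp"
begin

text \<open>
  Write \<open>\<chi>(L) = q + 1\<close>; an edge of \<open>L\<close> forces \<open>q \<ge> 1\<close>. The claim is that
  \<open>log\<^sub>2 M\<^sub>L(n)\<close> equals \<open>n\<^sup>2/(2q)\<close> up to \<open>o(n\<^sup>2)\<close>.

  Upper bound. Call a pair of vertices congruent if its two members agree modulo \<open>q\<close>. Two graphs
  of a family that have the same congruent edges differ only in edges that the colouring by
  residues modulo \<open>q\<close> makes bichromatic, so their difference is \<open>q\<close>-colourable and contains no copy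
  of \<open>L\<close>. Thus a graph of the family is determined by its congruent edges, and there are at most
  \<open>n(n-1)/(2q)\<close> congruent pairs (\<open>card_difference_family_le\<close>, \<open>card_mod_pairs_le\<close>).

  Lower bound. If a family is maximal, then every graph on \<open>{1..n}\<close> is the symmetric difference of
  a member and an \<open>L\<close>-free graph, so \<open>M\<^sub>L(n)\<close> times the number of \<open>L\<close>-free graphs is at least
  \<open>2\<close> to the power \<open>n(n-1)/2\<close> (\<open>max_family_size_covering\<close>). It remains to see that there are at most
  \<open>2\<close> to the power \<open>(1 - 1/q + o(1)) n\<^sup>2/2\<close> many \<open>L\<close>-free graphs, a theorem of Erdos, Frankl and Rodl.
  With \<open>t\<close> the number of vertices of \<open>L\<close>, the complete \<open>(q+1)\<close>-partite graph \<open>K\<^sub>q\<^sub>+\<^sub>1(t)\<close> with parts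
  of size \<open>t\<close> contains \<open>L\<close>, so it suffices to count \<open>K\<^sub>q\<^sub>+\<^sub>1(t)\<close>-free graphs.

  The count (\<open>card_multipartite_free_powr_le\<close>) is elementary, in the style of Erdos, Kleitman and
  Rothschild, by induction on the number \<open>r\<close> of parts: suppose that there are few
  \<open>K\<^sub>r(T)\<close>-free graphs for every \<open>T\<close>, and consider a \<open>K\<^sub>r\<^sub>+\<^sub>1(t)\<close>-free graph that does contain a
  \<open>K\<^sub>r(T)\<close>, with vertex set \<open>B\<close> of size \<open>b = rT\<close> for a large constant \<open>T\<close>. If more than a constant
  number of vertices outside \<open>B\<close> had \<open>t\<close> neighbours in each part, then \<open>t\<close> of them would have the
  same neighbourhood in \<open>B\<close>, which gives a \<open>K\<^sub>r\<^sub>+\<^sub>1(t)\<close>. All other vertices are nearly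
  non-adjacent to one part and so have only about \<open>2\<close> to the power \<open>(1 - 1/r) b\<close> possible
  neighbourhoods in \<open>B\<close>. Hence deleting \<open>B\<close> costs about \<open>(1 - 1/r) b n\<close> in the exponent, which
  matches the decrease of \<open>(1 - 1/r) n\<^sup>2/2\<close> from \<open>n\<close> to \<open>n - b\<close>; the surplus \<open>\<epsilon> b n\<close> that an exponent
  \<open>1 - 1/r + \<epsilon>\<close> leaves absorbs the errors and the choice of \<open>B\<close>.
\<close>

section \<open>Weighted counting of functions and subsets\<close>

text \<open>
  Give a function the weight \<open>x\<close> to the number of arguments that it sends into \<open>G\<close>. Each function to
  be counted has weight at least \<open>x ^ M\<close>, and the total weight of all functions is a product over
  \<open>V\<close>. When \<open>M\<close> is bounded and \<open>x\<close> is about \<open>1 / card G\<close>, the members of \<open>G\<close> cost only a constant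
  factor overall.
\<close>

lemma card_few_members_le:
  fixes x :: real
  assumes V: "finite V" and X: "finite X" and G: "G \<subseteq> X" and x: "0 < x" "x \<le> 1"
  shows "real (card {N \<in> V \<rightarrow>\<^sub>E X. card {v\<in>V. N v \<in> G} \<le> M})
           \<le> (1 / x) ^ M * (real (card (X - G)) + x * real (card G)) ^ card V"
proof -
  let ?w = "\<lambda>y. if y \<in> G then x else 1"
  let ?F = "V \<rightarrow>\<^sub>E X"
  have fF: "finite ?F" using V X by (simp add: finite_PiE)
  have weight: "(\<Prod>v\<in>V. ?w (N v)) = x ^ card {v\<in>V. N v \<in> G}" for N
    using V by (simp add: prod.If_cases Int_def)
  have "real (card {N \<in> ?F. card {v\<in>V. N v \<in> G} \<le> M})
      = (\<Sum>N\<in>{N \<in> ?F. card {v\<in>V. N v \<in> G} \<le> M}. 1)" by simp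
  also have "\<dots> \<le> (\<Sum>N\<in>{N \<in> ?F. card {v\<in>V. N v \<in> G} \<le> M}. (1 / x) ^ M * (\<Prod>v\<in>V. ?w (N v)))"
  proof (rule sum_mono)
    fix N assume "N \<in> {N \<in> ?F. card {v\<in>V. N v \<in> G} \<le> M}"
    then have "x ^ M \<le> x ^ card {v\<in>V. N v \<in> G}"
      using x by (intro power_decreasing) auto
    then show "1 \<le> (1 / x) ^ M * (\<Prod>v\<in>V. ?w (N v))"
      unfolding weight using x by (simp add: power_one_over field_simps)
  qed
  also have "\<dots> \<le> (\<Sum>N\<in>?F. (1 / x) ^ M * (\<Prod>v\<in>V. ?w (N v)))"
    using fF x by (intro sum_mono2) (auto intro!: mult_nonneg_nonneg prod_nonneg)
  also have "\<dots> = (1 / x) ^ M * (\<Prod>v\<in>V. \<Sum>y\<in>X. ?w y)"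
    using V X by (subst prod_sum_PiE) (auto simp: sum_distrib_left)
  also have "(\<Sum>y\<in>X. ?w y) = real (card (X - G)) + x * real (card G)"
  proof -
    have "X \<inter> {y. y \<in> G} = G" "X \<inter> - {y. y \<in> G} = X - G" using G by auto
    then show ?thesis using X by (simp add: sum.If_cases)
  qed
  finally show ?thesis by simp
qed

text \<open>The same weighting for subsets: the weights \<open>x ^ card Y\<close> add up to \<open>(1 + x) ^ card A\<close>.\<close>
lemma card_small_subsets_le:
  fixes x :: real
  assumes A: "finite A" and x: "0 < x" "x \<le> 1"
  shows "real (card {Y. Y \<subseteq> A \<and> card Y \<le> t}) \<le> (1 / x) ^ t * (1 + x) ^ card A"
proof -
  have "real (card {Y. Y \<subseteq> A \<and> card Y \<le> t}) = (\<Sum>Y\<in>{Y. Y \<subseteq> A \<and> card Y \<le> t}. 1)" by simp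
  also have "\<dots> \<le> (\<Sum>Y\<in>{Y. Y \<subseteq> A \<and> card Y \<le> t}. (1 / x) ^ t * x ^ card Y)"
  proof (rule sum_mono)
    fix Y assume "Y \<in> {Y. Y \<subseteq> A \<and> card Y \<le> t}"
    then have "x ^ t \<le> x ^ card Y" using x by (intro power_decreasing) auto
    then show "1 \<le> (1 / x) ^ t * x ^ card Y" using x by (simp add: power_one_over field_simps)
  qed
  also have "\<dots> \<le> (\<Sum>Y\<in>Pow A. (1 / x) ^ t * x ^ card Y)"
    using A x by (intro sum_mono2) auto
  also have "\<dots> = (1 / x) ^ t * (1 + x) ^ card A"
    using prod_add[OF A, of "\<lambda>_. x" "\<lambda>_. 1"] by (simp add: sum_distrib_left[symmetric] add.commute)
  finally show ?thesis .
qed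

text \<open>
  A set that meets some part in at most \<open>t\<close> points consists of a small subset of this part and an
  arbitrary subset of the rest of \<open>B\<close>. So for large \<open>T\<close> one of the \<open>r\<close> parts contributes almost
  nothing to the exponent.
\<close>
lemma card_sparse_on_some_part_le:
  fixes x :: real
  assumes B: "finite B" and A: "\<And>i. i < r \<Longrightarrow> A i \<subseteq> B \<and> card (A i) = T" and x: "0 < x" "x \<le> 1"
  shows "real (card {X. X \<subseteq> B \<and> (\<exists>i<r. card (X \<inter> A i) \<le> t)})
           \<le> real r * ((1 / x) ^ t * (1 + x) ^ T * 2 ^ (card B - T))"
proof -
  let ?S = "\<lambda>i. {Y. Y \<subseteq> A i \<and> card Y \<le> t} \<times> Pow (B - A i)"
  have fin: "finite (A i)" if "i < r" for i using A[OF that] B finite_subset by blast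
  have finS: "finite (?S i)" if "i < r" for i
    using fin[OF that] B by auto
  have sub: "{X. X \<subseteq> B \<and> (\<exists>i<r. card (X \<inter> A i) \<le> t)} \<subseteq> (\<Union>i<r. (\<lambda>(Y, Z). Y \<union> Z) ` ?S i)"
  proof
    fix X assume "X \<in> {X. X \<subseteq> B \<and> (\<exists>i<r. card (X \<inter> A i) \<le> t)}"
    then obtain i where i: "i < r" "card (X \<inter> A i) \<le> t" "X \<subseteq> B" by auto
    have "X = (\<lambda>(Y, Z). Y \<union> Z) (X \<inter> A i, X - A i)" by auto
    moreover have "(X \<inter> A i, X - A i) \<in> ?S i" using i by auto
    ultimately show "X \<in> (\<Union>i<r. (\<lambda>(Y, Z). Y \<union> Z) ` ?S i)" using i(1) by blast
  qed
  have "card {X. X \<subseteq> B \<and> (\<exists>i<r. card (X \<inter> A i) \<le> t)} \<le> card (\<Union>i<r. (\<lambda>(Y, Z). Y \<union> Z) ` ?S i)"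
    using finS by (intro card_mono sub) auto
  also have "\<dots> \<le> (\<Sum>i<r. card ((\<lambda>(Y, Z). Y \<union> Z) ` ?S i))" by (rule card_UN_le) simp
  also have "\<dots> \<le> (\<Sum>i<r. card (?S i))" by (intro sum_mono card_image_le) (use finS in auto)
  finally have "real (card {X. X \<subseteq> B \<and> (\<exists>i<r. card (X \<inter> A i) \<le> t)}) \<le> real (\<Sum>i<r. card (?S i))"
    by (simp only: of_nat_le_iff)
  also have "\<dots> = (\<Sum>i<r. real (card (?S i)))" by (rule of_nat_sum)
  also have "\<dots> \<le> (\<Sum>i<r. (1 / x) ^ t * (1 + x) ^ T * 2 ^ (card B - T))"
  proof (rule sum_mono)
    fix i assume "i \<in> {..<r}"
    then have i: "i < r" by simp
    have "card (Pow (B - A i)) = 2 ^ (card B - T)"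
      using A[OF i] fin[OF i] B by (simp add: card_Pow card_Diff_subset)
    then have "real (card (?S i)) = real (card {Y. Y \<subseteq> A i \<and> card Y \<le> t}) * 2 ^ (card B - T)"
      by (simp add: card_cartesian_product)
    also have "\<dots> \<le> ((1 / x) ^ t * (1 + x) ^ T) * 2 ^ (card B - T)"
      using card_small_subsets_le[OF fin[OF i] x, of t] A[OF i] by (intro mult_right_mono) auto
    finally show "real (card (?S i)) \<le> (1 / x) ^ t * (1 + x) ^ T * 2 ^ (card B - T)" .
  qed
  finally show ?thesis by simp
qed

section \<open>Graphs without a complete multipartite subgraph\<close>

definition pairs :: "'v set \<Rightarrow> 'v set set" where
  "pairs V = {e. e \<subseteq> V \<and> card e = 2}"

lemma finite_pairs [simp]: "finite V \<Longrightarrow> finite (pairs V)"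
  unfolding pairs_def by (rule finite_subset[of _ "Pow V"]) auto

lemma card_pairs: "finite V \<Longrightarrow> card (pairs V) = card V choose 2"
  unfolding pairs_def by (rule n_subsets)

lemma card_pairs_le_square: "finite V \<Longrightarrow> card (pairs V) \<le> (card V)\<^sup>2"
  by (cases "card V") (auto simp: card_pairs choose_two power2_eq_square)

text \<open>
  A copy of \<open>K\<^sub>r(t)\<close>. Disjointness of the parts is a consequence as soon as \<open>E\<close> contains no loops;
  see \<open>complete_parts_disjoint\<close>.
\<close>
definition complete_parts :: "nat \<Rightarrow> nat \<Rightarrow> 'v set \<Rightarrow> 'v set set \<Rightarrow> (nat \<Rightarrow> 'v set) \<Rightarrow> bool" where
  "complete_parts r t V E A \<longleftrightarrow>
     (\<forall>i<r. A i \<subseteq> V \<and> card (A i) = t) \<and>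
     (\<forall>i<r. \<forall>j<r. i \<noteq> j \<longrightarrow> (\<forall>x\<in>A i. \<forall>y\<in>A j. {x, y} \<in> E))"

definition multipartite_free :: "nat \<Rightarrow> nat \<Rightarrow> 'v set \<Rightarrow> 'v set set set" where
  "multipartite_free r t V = {E. E \<subseteq> pairs V \<and> (\<nexists>A. complete_parts r t V E A)}"

lemma finite_multipartite_free [simp]: "finite V \<Longrightarrow> finite (multipartite_free r t V)"
  unfolding multipartite_free_def by (rule finite_subset[of _ "Pow (pairs V)"]) auto

lemma card_multipartite_free_le:
  "finite V \<Longrightarrow> card (multipartite_free r t V) \<le> 2 ^ card (pairs V)"
  unfolding multipartite_free_def
  by (subst card_Pow[symmetric]) (auto intro!: card_mono)

lemma complete_parts_disjoint:
  assumes "complete_parts r t V E A" and "E \<subseteq> pairs V" and "i < r" "j < r" "i \<noteq> j"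
  shows "A i \<inter> A j = {}"
proof (rule ccontr)
  assume "A i \<inter> A j \<noteq> {}"
  then obtain x where "x \<in> A i" "x \<in> A j" by auto
  then have "{x, x} \<in> E" using assms unfolding complete_parts_def by blast
  then show False using assms(2) unfolding pairs_def by auto
qed

lemma multipartite_free_restrict:
  assumes "E \<in> multipartite_free r t V" and "U \<subseteq> V"
  shows "E \<inter> pairs U \<in> multipartite_free r t U"
proof -
  have "complete_parts r t V E A" if "complete_parts r t U (E \<inter> pairs U) A" for A
    using that assms(2) unfolding complete_parts_def by blast
  then show ?thesis using assms(1) unfolding multipartite_free_def by auto
qed

text \<open>
  By the pigeonhole principle, more than \<open>t * 2 ^ card B\<close> vertices include more than \<open>t\<close> with the same
  neighbourhood \<open>X\<close> in \<open>B\<close>. If \<open>X\<close> has \<open>t\<close> points in every part, then \<open>t\<close> points of \<open>X\<close> from each part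
  together with \<open>t\<close> of these vertices as an additional part form a \<open>K\<^sub>r\<^sub>+\<^sub>1(t)\<close>.
\<close>
lemma few_dense_vertices:
  assumes V: "finite V" and E: "E \<in> multipartite_free (Suc r) t V"
    and A: "complete_parts r T V E A"
  defines "B \<equiv> \<Union>i<r. A i"
  shows "card {v \<in> V - B. \<forall>i<r. t \<le> card ({x\<in>B. {v, x} \<in> E} \<inter> A i)} \<le> t * 2 ^ card B"
proof (rule ccontr)
  define S where "S = {v \<in> V - B. \<forall>i<r. t \<le> card ({x\<in>B. {v, x} \<in> E} \<inter> A i)}"
  define N where "N v = {x\<in>B. {v, x} \<in> E}" for v
  assume "\<not> card {v \<in> V - B. \<forall>i<r. t \<le> card ({x\<in>B. {v, x} \<in> E} \<inter> A i)} \<le> t * 2 ^ card B"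
  then have big: "t * 2 ^ card B < card S" by (simp add: S_def)
  have AV: "A i \<subseteq> V" if "i < r" for i using A that unfolding complete_parts_def by auto
  have finA: "finite (A i)" if "i < r" for i using AV[OF that] V finite_subset by blast
  have finB: "finite B" unfolding B_def using finA by auto
  have finS: "finite S" unfolding S_def using V by auto
  have "\<exists>X\<in>Pow B. card S \<le> card (N -` {X} \<inter> S) * card (Pow B)"
    using finS finB by (intro pigeonhole_card) (auto simp: N_def)
  then obtain X where X: "X \<subseteq> B" and le: "card S \<le> card (N -` {X} \<inter> S) * 2 ^ card B"
    using finB by (auto simp: card_Pow)
  have "t * 2 ^ card B < card (N -` {X} \<inter> S) * 2 ^ card B" using big le by linarith
  then have fibre: "t < card (N -` {X} \<inter> S)" by simp
  then obtain W where W: "W \<subseteq> N -` {X} \<inter> S" "card W = t"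
    using obtain_subset_with_card_n[of t "N -` {X} \<inter> S"] by (metis less_imp_le)
  have "N -` {X} \<inter> S \<noteq> {}" using fibre by force
  then obtain v where "v \<in> S" "N v = X" by auto
  then have XA: "t \<le> card (X \<inter> A i)" if "i < r" for i
    using that unfolding S_def N_def by auto
  have "\<exists>C. C \<subseteq> X \<inter> A i \<and> card C = t" if "i < r" for i
    using obtain_subset_with_card_n[OF XA[OF that]] by metis
  then obtain C where C: "\<And>i. i < r \<Longrightarrow> C i \<subseteq> X \<inter> A i \<and> card (C i) = t" by metis
  define C' where "C' i = (if i < r then C i else W)" for i
  have WX: "{w, x} \<in> E" if "w \<in> W" "x \<in> X" for w x
  proof -
    have "N w = X" using W(1) that(1) by auto
    then show ?thesis using that(2) unfolding N_def by auto
  qed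
  have "complete_parts (Suc r) t V E C'"
    unfolding complete_parts_def
  proof (intro conjI allI impI ballI)
    fix i assume "i < Suc r"
    show "C' i \<subseteq> V"
      using C[of i] AV[of i] W(1) unfolding C'_def S_def by (cases "i < r") auto
    show "card (C' i) = t" using C[of i] W(2) by (auto simp: C'_def)
  next
    fix i j x y assume ij: "i < Suc r" "j < Suc r" "i \<noteq> j" and xy: "x \<in> C' i" "y \<in> C' j"
    consider "i < r" "j < r" | "i < r" "j = r" | "i = r" "j < r" using ij by linarith
    then show "{x, y} \<in> E"
    proof cases
      case 1
      then have "x \<in> A i" "y \<in> A j" using xy C[of i] C[of j] by (auto simp: C'_def)
      then show ?thesis using A 1 ij unfolding complete_parts_def by blast
    next
      case 2
      then have "x \<in> X" "y \<in> W" using xy C[of i] by (auto simp: C'_def)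
      then show ?thesis using WX[of y x] by (simp add: insert_commute)
    next
      case 3
      then have "x \<in> W" "y \<in> X" using xy C[of j] by (auto simp: C'_def)
      then show ?thesis by (rule WX)
    qed
  qed
  then show False using E unfolding multipartite_free_def by blast
qed

text \<open>
  Every pair lies outside \<open>B\<close>, inside \<open>B\<close>, or crosses from one to the other, and the crossing edges
  are recorded by the neighbourhoods in \<open>B\<close>.
\<close>
lemma inj_on_split_at:
  "inj_on (\<lambda>E. (E \<inter> pairs (V - B), E \<inter> pairs B, \<lambda>v\<in>V - B. {x\<in>B. {v, x} \<in> E})) (Pow (pairs V))"
proof (rule inj_onI)
  fix E E' assume "E \<in> Pow (pairs V)" "E' \<in> Pow (pairs V)"
    and eq: "(E \<inter> pairs (V - B), E \<inter> pairs B, \<lambda>v\<in>V - B. {x\<in>B. {v, x} \<in> E})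
           = (E' \<inter> pairs (V - B), E' \<inter> pairs B, \<lambda>v\<in>V - B. {x\<in>B. {v, x} \<in> E'})"
  then have sub: "E \<subseteq> pairs V" "E' \<subseteq> pairs V" by auto
  have out: "e \<in> E \<longleftrightarrow> e \<in> E'" if "e \<in> pairs (V - B) \<union> pairs B" for e using eq that by auto
  have cross: "{v, x} \<in> E \<longleftrightarrow> {v, x} \<in> E'" if "v \<in> V - B" "x \<in> B" for v x
  proof -
    have "(\<lambda>v\<in>V - B. {x\<in>B. {v, x} \<in> E}) v = (\<lambda>v\<in>V - B. {x\<in>B. {v, x} \<in> E'}) v" using eq by simp
    then show ?thesis using that by auto
  qed
  have "e \<in> E \<longleftrightarrow> e \<in> E'" if e_in: "e \<in> pairs V" for e
  proof -
    obtain x y where e: "e = {x, y}" "x \<noteq> y"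
      using e_in card_2_iff[of e] unfolding pairs_def by blast
    then have V: "x \<in> V" "y \<in> V" using e_in unfolding pairs_def by auto
    consider "x \<in> B" "y \<in> B" | "x \<notin> B" "y \<notin> B" | "x \<notin> B" "y \<in> B" | "x \<in> B" "y \<notin> B" by blast
    then show ?thesis
    proof cases
      case 1 then show ?thesis using out e by (auto simp: pairs_def)
    next
      case 2 then show ?thesis using out e V by (auto simp: pairs_def)
    next
      case 3 then show ?thesis using cross[of x y] e V by auto
    next
      case 4 then show ?thesis using cross[of y x] e V by (auto simp: insert_commute)
    qed
  qed
  then show "E = E'" using sub by blast
qed

text \<open>
  Counting a graph through its three pieces relative to \<open>B\<close>: the piece outside is again free of
  \<open>K\<^sub>r\<^sub>+\<^sub>1(t)\<close>, the piece inside has boundedly many values, and the neighbourhoods in \<open>B\<close> of all but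
  boundedly many vertices are sparse on some part.
\<close>
lemma card_extensions_le:
  fixes V :: "'v set" and x :: real
  assumes V: "finite V"
    and A: "\<And>i. i < r \<Longrightarrow> A i \<subseteq> V \<and> card (A i) = T"
    and x: "0 < x" "x \<le> 1"
  defines "B \<equiv> \<Union>i<r. A i"
  shows "real (card {E \<in> multipartite_free (Suc r) t V. complete_parts r T V E A})
     \<le> 2 ^ (card B)\<^sup>2 * 2 ^ (card B * (t * 2 ^ card B))
         * (real r * ((1 / x) ^ t * (1 + x) ^ T * 2 ^ (card B - T)) + 1) ^ card V
         * real (card (multipartite_free (Suc r) t (V - B)))"
proof -
  define M where "M = t * 2 ^ card B"
  define G where "G = {X. X \<subseteq> B \<and> (\<forall>i<r. t \<le> card (X \<inter> A i))}"
  define bad where "bad = real r * ((1 / x) ^ t * (1 + x) ^ T * 2 ^ (card B - T))"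
  define P where "P = {N \<in> (V - B) \<rightarrow>\<^sub>E Pow B. card {v \<in> V - B. N v \<in> G} \<le> M}"
  let ?\<phi> = "\<lambda>E. (E \<inter> pairs (V - B), E \<inter> pairs B, \<lambda>v\<in>V - B. {x\<in>B. {v, x} \<in> E})"
  let ?S = "{E \<in> multipartite_free (Suc r) t V. complete_parts r T V E A}"
  have BV: "B \<subseteq> V" using A unfolding B_def by blast
  have finB: "finite B" using BV V finite_subset by blast
  have finP: "finite P" unfolding P_def using V finB by (auto simp: finite_PiE)
  have img: "?\<phi> ` ?S \<subseteq> multipartite_free (Suc r) t (V - B) \<times> Pow (pairs B) \<times> P"
  proof (rule image_subsetI)
    fix E assume E: "E \<in> ?S"
    have eq: "{v \<in> V - B. (\<lambda>v\<in>V - B. {x\<in>B. {v, x} \<in> E}) v \<in> G}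
        = {v \<in> V - B. \<forall>i<r. t \<le> card ({x\<in>B. {v, x} \<in> E} \<inter> A i)}"
      by (auto simp: G_def)
    have "card {v \<in> V - B. \<forall>i<r. t \<le> card ({x\<in>B. {v, x} \<in> E} \<inter> A i)} \<le> M"
      unfolding M_def B_def
    proof (rule few_dense_vertices[OF V])
      show "E \<in> multipartite_free (Suc r) t V" "complete_parts r T V E A" using E by simp_all
    qed
    then have "card {v \<in> V - B. (\<lambda>v\<in>V - B. {x\<in>B. {v, x} \<in> E}) v \<in> G} \<le> M"
      by (simp only: eq)
    then have "(\<lambda>v\<in>V - B. {x\<in>B. {v, x} \<in> E}) \<in> P" unfolding P_def by auto
    moreover have "E \<inter> pairs (V - B) \<in> multipartite_free (Suc r) t (V - B)"
      using E by (intro multipartite_free_restrict[of _ _ _ V]) auto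
    ultimately show "?\<phi> E \<in> multipartite_free (Suc r) t (V - B) \<times> Pow (pairs B) \<times> P" by auto
  qed
  have "card ?S \<le> card (multipartite_free (Suc r) t (V - B) \<times> Pow (pairs B) \<times> P)"
  proof (rule card_inj_on_le[OF _ img])
    show "inj_on ?\<phi> ?S"
      by (rule inj_on_subset[OF inj_on_split_at[of V B]]) (auto simp: multipartite_free_def)
    show "finite (multipartite_free (Suc r) t (V - B) \<times> Pow (pairs B) \<times> P)"
      using V finB finP by auto
  qed
  also have "\<dots> = card (multipartite_free (Suc r) t (V - B)) * (2 ^ card (pairs B) * card P)"
    using finB by (simp add: card_cartesian_product card_Pow)
  finally have "real (card ?S)
      \<le> real (card (multipartite_free (Suc r) t (V - B)) * (2 ^ card (pairs B) * card P))"
    by (simp only: of_nat_le_iff)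
  then have main: "real (card ?S)
      \<le> real (card (multipartite_free (Suc r) t (V - B))) * (2 ^ card (pairs B) * real (card P))"
    by simp
  \<comment> \<open>The weight \<open>1 / 2 ^ card B\<close> makes all dense neighbourhoods together count at most once;
    this is the summand 1 next to \<open>bad\<close>.\<close>
  have cardP: "real (card P) \<le> 2 ^ (card B * M) * (bad + 1) ^ card V"
  proof -
    let ?y = "1 / 2 ^ card B :: real"
    have G: "G \<subseteq> Pow B" by (auto simp: G_def)
    have "card G \<le> 2 ^ card B"
      using card_mono[OF _ G] finB by (simp add: card_Pow)
    then have "real (card G) \<le> 2 ^ card B" by (metis of_nat_le_iff of_nat_numeral of_nat_power)
    then have good: "?y * real (card G) \<le> 1" by (simp add: field_simps)
    have "Pow B - G \<subseteq> {X. X \<subseteq> B \<and> (\<exists>i<r. card (X \<inter> A i) \<le> t)}"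
    proof
      fix X assume "X \<in> Pow B - G"
      then obtain i where "X \<subseteq> B" "i < r" "\<not> t \<le> card (X \<inter> A i)" unfolding G_def by blast
      then show "X \<in> {X. X \<subseteq> B \<and> (\<exists>i<r. card (X \<inter> A i) \<le> t)}"
        by (auto intro!: exI[of _ i])
    qed
    then have "card (Pow B - G) \<le> card {X. X \<subseteq> B \<and> (\<exists>i<r. card (X \<inter> A i) \<le> t)}"
      using finB by (intro card_mono) auto
    moreover have "real (card {X. X \<subseteq> B \<and> (\<exists>i<r. card (X \<inter> A i) \<le> t)}) \<le> bad"
      unfolding bad_def
    proof (rule card_sparse_on_some_part_le[OF finB _ x])
      show "A i \<subseteq> B \<and> card (A i) = T" if "i < r" for i
        using A[OF that] that unfolding B_def by blast
    qed
    ultimately have badle: "real (card (Pow B - G)) \<le> bad" by linarith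
    have "bad \<ge> 0" unfolding bad_def using x by simp
    have "real (card P) \<le> (1 / ?y) ^ M * (real (card (Pow B - G)) + ?y * real (card G)) ^ card (V - B)"
      unfolding P_def using V finB G by (intro card_few_members_le) auto
    also have "\<dots> \<le> (1 / ?y) ^ M * (bad + 1) ^ card (V - B)"
      using badle good by (intro mult_left_mono power_mono add_mono) auto
    also have "\<dots> \<le> (1 / ?y) ^ M * (bad + 1) ^ card V"
      using \<open>bad \<ge> 0\<close> V by (intro mult_left_mono power_increasing card_mono) auto
    finally show ?thesis by (simp add: power_mult)
  qed
  have "2 ^ card (pairs B) \<le> (2 :: real) ^ (card B)\<^sup>2"
    using card_pairs_le_square[OF finB] by (intro power_increasing) auto
  then have "2 ^ card (pairs B) * real (card P)
      \<le> 2 ^ (card B)\<^sup>2 * (2 ^ (card B * M) * (bad + 1) ^ card V)"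
    using cardP by (intro mult_mono) auto
  then have "real (card ?S) \<le> real (card (multipartite_free (Suc r) t (V - B))) *
      (2 ^ (card B)\<^sup>2 * (2 ^ (card B * M) * (bad + 1) ^ card V))"
    using main by (meson mult_left_mono of_nat_0_le_iff order_trans)
  then show ?thesis by (simp only: bad_def M_def mult_ac)
qed


section \<open>The number of graphs without a complete multipartite subgraph\<close>

text \<open>
  A graph either has no \<open>K\<^sub>r(T)\<close> at all or has one on some choice of parts. The crude bound
  \<open>2 ^ (card V * r)\<close> for the number of choices is affordable, because peeling off a large \<open>K\<^sub>r(T)\<close>
  gains a larger multiple of \<open>card V\<close> in the exponent.
\<close>
lemma card_multipartite_free_split:
  fixes D :: real
  assumes V: "finite V"
    and D: "\<And>A. (\<And>i. i < r \<Longrightarrow> A i \<subseteq> V) \<Longrightarrow>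
           real (card {E \<in> multipartite_free (Suc r) t V. complete_parts r T V E A}) \<le> D"
  shows "real (card (multipartite_free (Suc r) t V))
           \<le> real (card (multipartite_free r T V)) + 2 ^ (card V * r) * D"
proof -
  let ?F = "multipartite_free (Suc r) t V"
  let ?C = "{..<r} \<rightarrow>\<^sub>E Pow V"
  let ?S = "\<lambda>A. {E \<in> ?F. complete_parts r T V E A}"
  have finC: "finite ?C" using V by (simp add: finite_PiE)
  have cardC: "card ?C = 2 ^ (card V * r)" using V by (simp add: card_PiE card_Pow power_mult)
  have "?F \<subseteq> multipartite_free r T V \<union> (\<Union>A\<in>?C. ?S A)"
  proof
    fix E assume E: "E \<in> ?F"
    show "E \<in> multipartite_free r T V \<union> (\<Union>A\<in>?C. ?S A)"
    proof (cases "E \<in> multipartite_free r T V")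
      case False
      then obtain A where A: "complete_parts r T V E A"
        using E unfolding multipartite_free_def by blast
      then have "complete_parts r T V E (restrict A {..<r})" by (simp add: complete_parts_def)
      moreover have "restrict A {..<r} \<in> ?C" using A by (auto simp: complete_parts_def)
      ultimately show ?thesis using E by blast
    qed simp
  qed
  then have "card ?F \<le> card (multipartite_free r T V \<union> (\<Union>A\<in>?C. ?S A))"
    using V finC by (intro card_mono) auto
  also have "\<dots> \<le> card (multipartite_free r T V) + card (\<Union>A\<in>?C. ?S A)" by (rule card_Un_le)
  also have "\<dots> \<le> card (multipartite_free r T V) + (\<Sum>A\<in>?C. card (?S A))"
    using finC by (intro add_left_mono card_UN_le)
  finally have "real (card ?F) \<le> real (card (multipartite_free r T V) + (\<Sum>A\<in>?C. card (?S A)))"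
    by (simp only: of_nat_le_iff)
  also have "\<dots> = real (card (multipartite_free r T V)) + (\<Sum>A\<in>?C. real (card (?S A)))" by simp
  also have "(\<Sum>A\<in>?C. real (card (?S A))) \<le> (\<Sum>A\<in>?C. D)"
    by (intro sum_mono D) (auto simp: PiE_def Pi_def)
  also have "(\<Sum>A\<in>?C. D) = 2 ^ (card V * r) * D" by (simp add: cardC)
  finally show ?thesis by simp
qed

text \<open>
  The limit density \<open>1 - 1/r\<close> of the Turan graph with \<open>r\<close> parts. In this form the value at \<open>r = 0\<close> is
  \<open>0\<close> by division by zero, which starts the induction: a vertex set with \<open>t\<close> elements already
  contains a \<open>K\<^sub>1(t)\<close>, so the number of \<open>K\<^sub>1(t)\<close>-free graphs is bounded.
\<close>
definition turan_density :: "nat \<Rightarrow> real" where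
  "turan_density r = (real r - 1) / real r"

lemma turan_density_nonneg: "0 \<le> turan_density r"
  by (cases r) (auto simp: turan_density_def)

lemma turan_density_mono_Suc: "turan_density r \<le> turan_density (Suc r)"
  by (cases r) (auto simp: turan_density_def field_simps)

lemma turan_density_mult: "0 < r \<Longrightarrow> turan_density r * real (r * T) = real (r * T) - real T"
  by (simp add: turan_density_def field_simps)

text \<open>
  The factor per vertex of \<open>card_extensions_le\<close> in exponential form. The exponent \<open>r T - T\<close>, the size
  of \<open>B\<close> without one part, is exactly \<open>turan_density r\<close> times \<open>card B\<close>; one error \<open>\<eta> T\<close> comes from the
  small subsets of the sparse part, the other absorbs the factors that do not grow with \<open>T\<close>.
\<close>
lemma card_extensions_powr_le:
  fixes V :: "'v set" and r t T :: nat and x \<eta> :: real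
  assumes V: "finite V" and r: "0 < r"
    and A: "complete_parts r T V E A" "E \<subseteq> pairs V"
    and x: "0 < x" "x \<le> 1" "1 + x = 2 powr \<eta>"
    and T: "real r * (1 / x) ^ t + 1 \<le> 2 powr (\<eta> * real T)" and \<eta>: "0 \<le> \<eta>"
  obtains B where "B \<subseteq> V" "card B = r * T"
    "real (card {E \<in> multipartite_free (Suc r) t V. complete_parts r T V E A})
     \<le> 2 powr (real ((r * T)\<^sup>2 + r * T * (t * 2 ^ (r * T)))
           + (turan_density r * real (r * T) + 2 * \<eta> * real T) * real (card V))
         * real (card (multipartite_free (Suc r) t (V - B)))"
proof -
  define B where "B = (\<Union>i<r. A i)"
  have parts: "A i \<subseteq> V \<and> card (A i) = T" if "i < r" for i
    using A that unfolding complete_parts_def by auto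
  have "card B = (\<Sum>i<r. card (A i))"
    unfolding B_def
  proof (rule card_UN_disjoint)
    show "\<forall>i\<in>{..<r}. finite (A i)" using parts V finite_subset by blast
    show "\<forall>i\<in>{..<r}. \<forall>j\<in>{..<r}. i \<noteq> j \<longrightarrow> A i \<inter> A j = {}"
      using complete_parts_disjoint[OF A] by simp
  qed simp
  then have cardB: "card B = r * T" using parts by simp
  have BV: "B \<subseteq> V" unfolding B_def using parts by blast
  let ?p = "2 powr (real (r * T) - real T) :: real"
  have "real r * ((1 / x) ^ t * (1 + x) ^ T * 2 ^ (r * T - T)) + 1
      = (real r * (1 / x) ^ t) * (2 powr (\<eta> * real T) * ?p) + 1"
  proof -
    have "(1 + x) ^ T = 2 powr (\<eta> * real T)"
      unfolding x(3) by (simp add: powr_powr[symmetric] powr_realpow)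
    moreover have "(2::real) ^ (r * T - T) = ?p"
      using r by (simp add: powr_realpow[symmetric] of_nat_diff)
    ultimately show ?thesis by simp
  qed
  also have "\<dots> \<le> (real r * (1 / x) ^ t) * (2 powr (\<eta> * real T) * ?p) + 2 powr (\<eta> * real T) * ?p"
  proof -
    have "1 \<le> 2 powr (\<eta> * real T)" using \<eta> by (intro ge_one_powr_ge_zero) auto
    moreover have "real T \<le> real (r * T)" using r by (cases r) auto
    then have "1 \<le> ?p" by (intro ge_one_powr_ge_zero) simp_all
    ultimately have "1 * 1 \<le> 2 powr (\<eta> * real T) * ?p" by (intro mult_mono) auto
    then show ?thesis by simp
  qed
  also have "\<dots> = (real r * (1 / x) ^ t + 1) * (2 powr (\<eta> * real T) * ?p)"
    by (simp add: algebra_simps)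
  also have "\<dots> \<le> 2 powr (\<eta> * real T) * (2 powr (\<eta> * real T) * ?p)"
    using T by (intro mult_right_mono) auto
  also have "\<dots> = 2 powr (turan_density r * real (r * T) + 2 * \<eta> * real T)"
    unfolding turan_density_mult[OF r] by (simp add: powr_add[symmetric] algebra_simps)
  finally have base: "real r * ((1 / x) ^ t * (1 + x) ^ T * 2 ^ (r * T - T)) + 1
      \<le> 2 powr (turan_density r * real (r * T) + 2 * \<eta> * real T)" .
  have "real (card {E \<in> multipartite_free (Suc r) t V. complete_parts r T V E A})
     \<le> 2 ^ (r * T)\<^sup>2 * 2 ^ (r * T * (t * 2 ^ (r * T)))
         * (real r * ((1 / x) ^ t * (1 + x) ^ T * 2 ^ (r * T - T)) + 1) ^ card V
         * real (card (multipartite_free (Suc r) t (V - B)))"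
    using card_extensions_le[of V r A T x t] V parts x unfolding B_def[symmetric] cardB by blast
  also have "\<dots> \<le> 2 ^ (r * T)\<^sup>2 * 2 ^ (r * T * (t * 2 ^ (r * T)))
         * (2 powr (turan_density r * real (r * T) + 2 * \<eta> * real T)) ^ card V
         * real (card (multipartite_free (Suc r) t (V - B)))"
    using base x by (intro mult_right_mono mult_left_mono power_mono) auto
  also have "2 ^ (r * T)\<^sup>2 * 2 ^ (r * T * (t * 2 ^ (r * T)))
         * (2 powr (turan_density r * real (r * T) + 2 * \<eta> * real T)) ^ card V
      = (2 powr (real ((r * T)\<^sup>2 + r * T * (t * 2 ^ (r * T)))
           + (turan_density r * real (r * T) + 2 * \<eta> * real T) * real (card V)) :: real)"
  proof -
    have "(2::real) ^ (r * T)\<^sup>2 * 2 ^ (r * T * (t * 2 ^ (r * T)))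
        = 2 powr real ((r * T)\<^sup>2 + r * T * (t * 2 ^ (r * T)))"
      by (subst powr_realpow, simp, rule power_add[symmetric])
    moreover have "(2 powr (turan_density r * real (r * T) + 2 * \<eta> * real T)) ^ card V
        = (2 powr ((turan_density r * real (r * T) + 2 * \<eta> * real T) * real (card V)) :: real)"
      by (subst powr_powr[symmetric], subst powr_realpow) simp_all
    ultimately show ?thesis by (simp only: powr_add)
  qed
  finally show ?thesis using that BV cardB by blast
qed

text \<open>
  Passing from \<open>n\<close> to \<open>n - r T\<close> lowers \<open>(\<alpha> + \<epsilon>) n\<^sup>2 / 2\<close> by about \<open>(\<alpha> + \<epsilon>) r T n\<close>. The part \<open>\<alpha> r T n\<close>
  pays for the neighbourhoods. Of \<open>\<epsilon> r T n\<close>, the error \<open>2 \<eta> T n\<close> takes at most one half, and the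
  other half is at least \<open>2 r n\<close>: it pays for the choice of the parts and leaves \<open>r n\<close>, which
  exceeds all constants for large \<open>n\<close>.
\<close>
lemma peeling_exponent_le:
  fixes n r T :: nat and \<alpha> \<epsilon> \<eta> c :: real
  assumes r: "0 < r" and \<epsilon>: "0 < \<epsilon>" and \<eta>: "\<eta> \<le> \<epsilon> / 4" and T: "4 \<le> \<epsilon> * real T"
    and n: "c + (\<alpha> + \<epsilon>) * (real (r * T))\<^sup>2 / 2 + 1 \<le> real n"
  shows "real n * real r + (c + (\<alpha> * real (r * T) + 2 * \<eta> * real T) * real n)
      + (\<alpha> + \<epsilon>) * (real n - real (r * T))\<^sup>2 / 2 \<le> (\<alpha> + \<epsilon>) * (real n)\<^sup>2 / 2 - 1"
proof -
  have "2 * \<eta> * real T \<le> \<epsilon> * real T / 2" using mult_right_mono[OF \<eta>, of "2 * real T"] by simp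
  also have "\<dots> \<le> real r * (\<epsilon> * real T) / 2" using r T mult_right_mono[of 1 "real r" "\<epsilon> * real T"] by simp
  finally have 1: "2 * \<eta> * real T \<le> real r * (\<epsilon> * real T) / 2" .
  have 2: "real r * 4 \<le> real r * (\<epsilon> * real T)" using T by (intro mult_left_mono) auto
  have "real r + 2 * \<eta> * real T - real r * (\<epsilon> * real T) \<le> -1"
    using 1 2 r by linarith
  then have "(real r + 2 * \<eta> * real T - real r * (\<epsilon> * real T)) * real n \<le> -1 * real n"
    by (intro mult_right_mono) auto
  moreover have "real n * real r + (c + (\<alpha> * real (r * T) + 2 * \<eta> * real T) * real n)
      + (\<alpha> + \<epsilon>) * (real n - real (r * T))\<^sup>2 / 2
     = (\<alpha> + \<epsilon>) * (real n)\<^sup>2 / 2 + c + (\<alpha> + \<epsilon>) * (real (r * T))\<^sup>2 / 2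
       + (real r + 2 * \<eta> * real T - real r * (\<epsilon> * real T)) * real n"
    by (simp add: power2_eq_square field_simps)
  ultimately show ?thesis using n by linarith
qed

text \<open>
  The parameters are chosen in this order: \<open>\<eta>\<close> small against \<open>\<epsilon>\<close>, then \<open>x\<close> with \<open>1 + x = 2 powr \<eta>\<close>, and
  last a \<open>T\<close> that is large against everything else; the cap \<open>\<eta> \<le> 1\<close> gives \<open>x \<le> 1\<close>.
\<close>
lemma exists_peeling_parameters:
  fixes \<epsilon> :: real
  assumes \<epsilon>: "0 < \<epsilon>"
  obtains x \<eta> :: real and T :: nat where "0 < x" "x \<le> 1" "1 + x = 2 powr \<eta>" "0 \<le> \<eta>" "\<eta> \<le> \<epsilon> / 4"
    "4 \<le> \<epsilon> * real T" "real r * (1 / x) ^ t + 1 \<le> 2 powr (\<eta> * real T)"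
proof -
  define \<eta> where "\<eta> = min 1 (\<epsilon> / 4)"
  define x where "x = 2 powr \<eta> - 1"
  have \<eta>: "0 < \<eta>" "\<eta> \<le> 1" "\<eta> \<le> \<epsilon> / 4" using \<epsilon> by (auto simp: \<eta>_def)
  have big: "1 < 2 powr \<eta>" using \<eta> by simp
  have "2 powr \<eta> \<le> 2 powr 1" using \<eta> by (intro powr_mono) auto
  then have x: "0 < x" "x \<le> 1" using big by (auto simp: x_def)
  obtain m where m: "real r * (1 / x) ^ t + 1 < (2 powr \<eta>) ^ m" using real_arch_pow[OF big] by blast
  obtain k where k: "4 / \<epsilon> < real k" using reals_Archimedean2 by blast
  define T where "T = max m k"
  have "4 \<le> \<epsilon> * real k" using k \<epsilon> by (simp add: field_simps)
  also have "\<dots> \<le> \<epsilon> * real T" using \<epsilon> by (auto simp: T_def)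
  finally have T1: "4 \<le> \<epsilon> * real T" .
  have "(2 powr \<eta>) ^ m \<le> (2 powr \<eta>) ^ T" using big by (intro power_increasing) (auto simp: T_def)
  also have "\<dots> = 2 powr (\<eta> * real T)" by (simp add: powr_powr[symmetric] powr_realpow)
  finally have "real r * (1 / x) ^ t + 1 \<le> 2 powr (\<eta> * real T)" using m by linarith
  then show ?thesis using that[of x \<eta> T] x \<eta> T1 by (simp add: x_def)
qed

text \<open>
  The outer induction is on \<open>r\<close>, the inner one on the size of \<open>V\<close>: the graphs without \<open>K\<^sub>r(T)\<close> and
  those from which a \<open>K\<^sub>r(T)\<close> can be peeled off each contribute at most half of the bound.
\<close>
lemma card_multipartite_free_powr_le:
  fixes \<epsilon> :: real
  assumes "0 < \<epsilon>"
  shows "\<exists>K>0. \<forall>V :: 'v set. finite V \<longrightarrow>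
     real (card (multipartite_free (Suc r) t V)) \<le> K * 2 powr ((turan_density r + \<epsilon>) * (real (card V))\<^sup>2 / 2)"
  using assms
proof (induction r arbitrary: t \<epsilon>)
  case (0 t \<epsilon>)
  have "real (card (multipartite_free (Suc 0) t V))
      \<le> 2 ^ t\<^sup>2 * 2 powr ((turan_density 0 + \<epsilon>) * (real (card V))\<^sup>2 / 2)" if V: "finite V" for V :: "'v set"
  proof (cases "t \<le> card V")
    case True
    then obtain C where C: "C \<subseteq> V" "card C = t" by (meson obtain_subset_with_card_n)
    have "complete_parts (Suc 0) t V E (\<lambda>_. C)" for E using C by (auto simp: complete_parts_def)
    then have "multipartite_free (Suc 0) t V = {}" by (auto simp: multipartite_free_def)
    then show ?thesis by simp
  next
    case False
    have "card (multipartite_free (Suc 0) t V) \<le> 2 ^ card (pairs V)"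
      by (rule card_multipartite_free_le[OF V])
    also have "\<dots> \<le> 2 ^ t\<^sup>2"
    proof (intro power_increasing)
      show "card (pairs V) \<le> t\<^sup>2"
        using card_pairs_le_square[OF V] False power_mono[of "card V" t 2] by linarith
    qed simp
    finally have "card (multipartite_free (Suc 0) t V) \<le> 2 ^ t\<^sup>2" .
    then have "real (card (multipartite_free (Suc 0) t V)) \<le> real (2 ^ t\<^sup>2)" by (simp only: of_nat_le_iff)
    then have "real (card (multipartite_free (Suc 0) t V)) \<le> 2 ^ t\<^sup>2 * 1" by simp
    also have "\<dots> \<le> 2 ^ t\<^sup>2 * 2 powr ((turan_density 0 + \<epsilon>) * (real (card V))\<^sup>2 / 2)"
      using 0 turan_density_nonneg[of 0] by (intro mult_left_mono ge_one_powr_ge_zero) auto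
    finally show ?thesis .
  qed
  then show ?case by (intro exI[of _ "2 ^ t\<^sup>2"]) auto
next
  case (Suc r' t \<epsilon>)
  define r where "r = Suc r'"
  define \<alpha> where "\<alpha> = turan_density r"
  have r: "0 < r" by (simp add: r_def)
  have \<epsilon>: "0 < \<epsilon>" by fact
  have \<alpha>: "0 \<le> \<alpha>" "turan_density r' \<le> \<alpha>"
    using turan_density_nonneg turan_density_mono_Suc by (auto simp: \<alpha>_def r_def)
  obtain x \<eta> :: real and T :: nat where x: "0 < x" "x \<le> 1" "1 + x = 2 powr \<eta>"
    and \<eta>: "0 \<le> \<eta>" "\<eta> \<le> \<epsilon> / 4" and T: "4 \<le> \<epsilon> * real T"
      "real r * (1 / x) ^ t + 1 \<le> 2 powr (\<eta> * real T)"
    using exists_peeling_parameters[OF \<epsilon>, of r t] by metis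
  obtain K0 where K0: "0 < K0" and base: "\<And>V :: 'v set. finite V \<Longrightarrow>
      real (card (multipartite_free r T V)) \<le> K0 * 2 powr ((turan_density r' + \<epsilon>) * (real (card V))\<^sup>2 / 2)"
    using Suc.IH[OF \<epsilon>, of T] unfolding r_def by blast
  define c where "c = real ((r * T)\<^sup>2 + r * T * (t * 2 ^ (r * T)))"
  obtain n0 :: nat where n0: "c + (\<alpha> + \<epsilon>) * (real (r * T))\<^sup>2 / 2 + 1 < real n0"
    using reals_Archimedean2 by blast
  \<comment> \<open>\<open>2 * K0\<close> leaves room for the graphs without \<open>K\<^sub>r(T)\<close>; \<open>2 ^ n0\<^sup>2\<close> covers all vertex sets that
    are too small for the peeling step.\<close>
  define K where "K = max (2 * K0) (2 ^ n0\<^sup>2)"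
  have K: "2 * K0 \<le> K" "2 ^ n0\<^sup>2 \<le> K" "0 < K" using K0 by (auto simp: K_def)
  let ?b = "\<lambda>V. 2 powr ((\<alpha> + \<epsilon>) * (real (card V))\<^sup>2 / 2)"
  have "real (card (multipartite_free (Suc r) t V)) \<le> K * ?b V" if "finite V" for V :: "'v set"
    using that
  proof (induction "card V" arbitrary: V rule: less_induct)
    case (less V)
    have b1: "1 \<le> ?b V" using \<alpha> \<epsilon> by (intro ge_one_powr_ge_zero) auto
    show ?case
    proof (cases "n0 \<le> card V")
      case False
      have "card (multipartite_free (Suc r) t V) \<le> 2 ^ card (pairs V)"
        by (rule card_multipartite_free_le[OF less.prems])
      also have "\<dots> \<le> 2 ^ n0\<^sup>2"
      proof (intro power_increasing)
        show "card (pairs V) \<le> n0\<^sup>2"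
          using card_pairs_le_square[OF less.prems] False power_mono[of "card V" n0 2] by linarith
      qed simp
      finally have "card (multipartite_free (Suc r) t V) \<le> 2 ^ n0\<^sup>2" .
      then have "real (card (multipartite_free (Suc r) t V)) \<le> real (2 ^ n0\<^sup>2)"
        by (simp only: of_nat_le_iff)
      also have "\<dots> \<le> K * 1" using K(2) by simp
      also have "K * 1 \<le> K * ?b V" using b1 K by (intro mult_left_mono) auto
      finally show ?thesis .
    next
      case True
      let ?n = "card V"
      define e where "e = c + (\<alpha> * real (r * T) + 2 * \<eta> * real T) * real ?n"
      define D where "D = 2 powr e * (K * 2 powr ((\<alpha> + \<epsilon>) * (real ?n - real (r * T))\<^sup>2 / 2))"
      have bound: "real (card {E \<in> multipartite_free (Suc r) t V. complete_parts r T V E A}) \<le> D" for A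
      proof (cases "{E \<in> multipartite_free (Suc r) t V. complete_parts r T V E A} = {}")
        case True
        then show ?thesis unfolding True using K by (simp add: D_def)
      next
        case False
        then obtain E where "complete_parts r T V E A" "E \<subseteq> pairs V"
          by (auto simp: multipartite_free_def)
        then obtain B where B: "B \<subseteq> V" "card B = r * T" and le:
          "real (card {E \<in> multipartite_free (Suc r) t V. complete_parts r T V E A})
             \<le> 2 powr e * real (card (multipartite_free (Suc r) t (V - B)))"
          unfolding e_def c_def \<alpha>_def
          by (rule card_extensions_powr_le[OF less.prems r _ _ x T(2) \<eta>(1)])
        have finB: "finite B" using B(1) less.prems finite_subset by blast
        have T0: "0 < T" using T(1) by (cases T) auto
        have bn: "r * T \<le> ?n" using B card_mono[OF less.prems B(1)] by simp
        have cardVB: "card (V - B) = ?n - r * T" using B finB by (simp add: card_Diff_subset)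
        have "0 < r * T" using r T0 by simp
        then have "card (V - B) < ?n" using cardVB bn by linarith
        then have "real (card (multipartite_free (Suc r) t (V - B))) \<le> K * ?b (V - B)"
          using less.hyps less.prems by blast
        also have "?b (V - B) = 2 powr ((\<alpha> + \<epsilon>) * (real ?n - real (r * T))\<^sup>2 / 2)"
          unfolding cardVB using bn by (simp only: of_nat_diff)
        finally have "2 powr e * real (card (multipartite_free (Suc r) t (V - B))) \<le> D"
          unfolding D_def by (intro mult_left_mono) auto
        then show ?thesis using le by linarith
      qed
      have "real (card (multipartite_free (Suc r) t V))
          \<le> real (card (multipartite_free r T V)) + 2 ^ (?n * r) * D"
        by (rule card_multipartite_free_split[OF less.prems bound])
      also have "real (card (multipartite_free r T V)) \<le> K / 2 * ?b V"
      proof -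
        have "real (card (multipartite_free r T V))
            \<le> K0 * 2 powr ((turan_density r' + \<epsilon>) * (real ?n)\<^sup>2 / 2)" by (rule base[OF less.prems])
        also have "\<dots> \<le> K / 2 * ?b V"
          using K K0 \<alpha> by (intro mult_mono powr_mono divide_right_mono mult_right_mono) auto
        finally show ?thesis .
      qed
      also have "2 ^ (?n * r) * D \<le> K / 2 * ?b V"
      proof -
        have "2 ^ (?n * r) * D = K * 2 powr (real ?n * real r + e
            + (\<alpha> + \<epsilon>) * (real ?n - real (r * T))\<^sup>2 / 2)"
          by (simp add: D_def powr_add powr_realpow[symmetric])
        also have "\<dots> \<le> K * 2 powr ((\<alpha> + \<epsilon>) * (real ?n)\<^sup>2 / 2 - 1)"
          unfolding e_def using n0 True K
          by (intro mult_left_mono powr_mono peeling_exponent_le r \<epsilon> \<eta> T) auto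
        also have "\<dots> = K / 2 * ?b V" by (simp add: powr_diff)
        finally show ?thesis .
      qed
      finally show ?thesis by simp
    qed
  qed
  then show ?case using K unfolding \<alpha>_def r_def by blast
qed


section \<open>Copies and colourings\<close>

lemma graphs_on_eq: "graphs_on n = UGraph {1..n} ` Pow (pairs {1..n})"
proof (intro equalityI subsetI)
  fix G assume "G \<in> graphs_on n"
  then have "G = UGraph {1..n} (edges G)" "edges G \<in> Pow (pairs {1..n})"
    unfolding graphs_on_def simple_graph_def pairs_def by (cases G; auto)+
  then show "G \<in> UGraph {1..n} ` Pow (pairs {1..n})" by blast
next
  fix G assume "G \<in> UGraph {1..n} ` Pow (pairs {1..n})"
  then obtain E where "E \<subseteq> pairs {1..n}" "G = UGraph {1..n} E" by blast
  then show "G \<in> graphs_on n" by (simp add: graphs_on_def simple_graph_def pairs_def)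
qed

lemma edges_graphs_on: "G \<in> graphs_on n \<Longrightarrow> edges G \<subseteq> pairs {1..n}"
  unfolding graphs_on_def simple_graph_def pairs_def by auto

lemma edge_in_vertices:
  "simple_graph G \<Longrightarrow> {u, v} \<in> edges G \<Longrightarrow> u \<in> vertices G \<and> v \<in> vertices G"
  unfolding simple_graph_def by auto

lemma contains_copyI:
  assumes L: "simple_graph L" and inj: "inj_on f (vertices L)" and img: "f ` vertices L \<subseteq> vertices G"
    and E: "\<And>u v. {u, v} \<in> edges L \<Longrightarrow> {f u, f v} \<in> edges G"
  shows "contains_copy G L"
proof -
  define H where "H = UGraph (f ` vertices L) ((`) f ` edges L)"
  have sub: "e \<subseteq> vertices L" "card e = 2" if "e \<in> edges L" for e
    using L that unfolding simple_graph_def by auto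
  have "simple_graph H"
    using L sub inj unfolding H_def simple_graph_def
    by (auto simp: card_image inj_on_subset)
  moreover have "edges H \<subseteq> edges G"
  proof
    fix e' assume "e' \<in> edges H"
    then obtain e where e: "e \<in> edges L" "e' = f ` e" by (auto simp: H_def)
    obtain u v where "e = {u, v}" using sub(2)[OF e(1)] card_2_iff[of e] by blast
    then show "e' \<in> edges G" using E[of u v] e by simp
  qed
  ultimately have "subgraph_of H G" using img by (simp add: subgraph_of_def H_def)
  moreover have "isomorphic_graphs L H"
    unfolding isomorphic_graphs_def
  proof (intro exI conjI ballI)
    show "bij_betw f (vertices L) (vertices H)" using inj by (simp add: bij_betw_def H_def)
    fix u v assume uv: "u \<in> vertices L" "v \<in> vertices L"
    have "{u, v} \<in> edges L" if "{f u, f v} \<in> edges H"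
    proof -
      have "f ` {u, v} \<in> (`) f ` edges L" using that by (simp add: H_def)
      then obtain e where e: "f ` {u, v} = f ` e" "e \<in> edges L" by (rule imageE)
      have "{u, v} \<subseteq> vertices L" using uv by simp
      then have "f ` e = f ` {u, v} \<longleftrightarrow> e = {u, v}"
        by (rule inj_on_image_eq_iff[OF inj sub(1)[OF e(2)]])
      with e(1) have "e = {u, v}" by simp
      then show ?thesis using e by simp
    qed
    moreover have "{f u, f v} \<in> edges H" if "{u, v} \<in> edges L"
      using that by (auto simp: H_def intro!: image_eqI[of _ _ "{u, v}"])
    ultimately show "{u, v} \<in> edges L \<longleftrightarrow> {f u, f v} \<in> edges H" by blast
  qed
  ultimately show ?thesis unfolding contains_copy_def by blast
qed

text \<open>The colouring of \<open>G\<close> is pulled back along the embedding of \<open>L\<close>.\<close>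
lemma colourable_of_contains_copy:
  assumes L: "simple_graph L" and copy: "contains_copy G L"
    and range: "\<And>x. c x < q" and proper: "\<And>u v. {u, v} \<in> edges G \<Longrightarrow> c u \<noteq> c v"
  shows "colourable L q"
proof -
  obtain H f where H: "subgraph_of H G"
    and iso: "\<And>u v. u \<in> vertices L \<Longrightarrow> v \<in> vertices L \<Longrightarrow> {u, v} \<in> edges L \<longleftrightarrow> {f u, f v} \<in> edges H"
    using copy unfolding contains_copy_def isomorphic_graphs_def by blast
  have "c (f u) \<noteq> c (f v)" if "{u, v} \<in> edges L" for u v
    using edge_in_vertices[OF L that] iso[of u v] that H proper unfolding subgraph_of_def by blast
  then show ?thesis unfolding colourable_def using range by (intro exI[of _ "c \<circ> f"]) auto
qed

text \<open>
  Each colour class of \<open>L\<close> has at most as many elements as a part, so it can be placed injectively in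
  its own part, and then all edges of \<open>L\<close> run between distinct parts.
\<close>
lemma contains_copy_of_complete_parts:
  assumes L: "simple_graph L" and col: "colourable L k"
    and E: "E \<subseteq> pairs W" and W: "finite W" and A: "complete_parts k (card (vertices L)) W E A"
  shows "contains_copy (UGraph W E) L"
proof -
  obtain c where c: "c ` vertices L \<subseteq> {..<k}" "\<And>u v. {u, v} \<in> edges L \<Longrightarrow> c u \<noteq> c v"
    using col unfolding colourable_def by blast
  have finL: "finite (vertices L)" using L by (simp add: simple_graph_def)
  have parts: "A i \<subseteq> W" "card (A i) = card (vertices L)" if "i < k" for i
    using A that by (auto simp: complete_parts_def)
  have "\<exists>g. g ` vertices L \<subseteq> A i \<and> inj_on g (vertices L)" if "i < k" for i
    using parts[OF that] finite_subset[OF _ W]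
    by (intro card_le_inj finL) auto
  then obtain g where g: "\<And>i. i < k \<Longrightarrow> g i ` vertices L \<subseteq> A i \<and> inj_on (g i) (vertices L)"
    by metis
  define f where "f v = g (c v) v" for v
  have ck: "c v < k" if "v \<in> vertices L" for v using c(1) that by auto
  have fA: "f v \<in> A (c v)" if "v \<in> vertices L" for v
    using g[OF ck[OF that]] that by (auto simp: f_def)
  show ?thesis
  proof (rule contains_copyI[OF L])
    show "inj_on f (vertices L)"
    proof (rule inj_onI)
      fix u v assume uv: "u \<in> vertices L" "v \<in> vertices L" "f u = f v"
      have "c u = c v"
        using complete_parts_disjoint[OF A E ck[OF uv(1)] ck[OF uv(2)]] fA[OF uv(1)] fA[OF uv(2)] uv(3)
        by auto
      then show "u = v" using g[OF ck[OF uv(1)]] uv by (auto simp: f_def inj_on_def)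
    qed
    show "f ` vertices L \<subseteq> vertices (UGraph W E)" using fA parts(1) ck by auto
    fix u v assume uv: "{u, v} \<in> edges L"
    then have V: "u \<in> vertices L" "v \<in> vertices L" using edge_in_vertices[OF L] by auto
    show "{f u, f v} \<in> edges (UGraph W E)"
      using A ck[OF V(1)] ck[OF V(2)] c(2)[OF uv] fA[OF V(1)] fA[OF V(2)]
      unfolding complete_parts_def by auto
  qed
qed

lemma colourable_chromatic_number:
  assumes "simple_graph L"
  shows "colourable L (chromatic_number L)"
proof -
  have "finite (vertices L)" using assms by (simp add: simple_graph_def)
  then obtain c :: "'a \<Rightarrow> nat" and m where c: "c ` vertices L = {i. i < m}" "inj_on c (vertices L)"
    using finite_imp_inj_to_nat_seg by metis
  have "c u \<noteq> c v" if e: "{u, v} \<in> edges L" for u v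
  proof -
    have "card {u, v} = 2" using assms e unfolding simple_graph_def by blast
    then have "u \<noteq> v" by auto
    then show ?thesis using c(2) edge_in_vertices[OF assms e] by (auto simp: inj_on_def)
  qed
  then have "colourable L m" unfolding colourable_def using c(1) by (intro exI[of _ c]) auto
  then show ?thesis unfolding chromatic_number_def by (rule LeastI)
qed

lemma chromatic_number_ge_2:
  assumes L: "simple_graph L" and E: "edges L \<noteq> {}"
  shows "2 \<le> chromatic_number L"
proof -
  obtain e where "e \<in> edges L" using E by blast
  moreover from this have "card e = 2" using L unfolding simple_graph_def by blast
  ultimately obtain u v where uv: "{u, v} \<in> edges L" using card_2_iff[of e] by blast
  obtain c :: "'a \<Rightarrow> nat" where c: "c ` vertices L \<subseteq> {..<chromatic_number L}"
    "\<And>u v. {u, v} \<in> edges L \<Longrightarrow> c u \<noteq> c v"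
    using colourable_chromatic_number[OF L] unfolding colourable_def by blast
  have "c u < chromatic_number L" "c v < chromatic_number L" "c u \<noteq> c v"
    using c edge_in_vertices[OF L uv] uv by auto
  then show ?thesis by linarith
qed

lemma not_colourable_below_chromatic_number: "q < chromatic_number L \<Longrightarrow> \<not> colourable L q"
  unfolding chromatic_number_def by (rule not_less_Least)

section \<open>Families are determined by their edges between congruent vertices\<close>

definition mod_pairs :: "nat \<Rightarrow> nat \<Rightarrow> nat set set" where
  "mod_pairs q n = {e \<in> pairs {1..n}. \<exists>u v. e = {u, v} \<and> u mod q = v mod q}"

text \<open>
  A pair is determined by its larger element \<open>v\<close> and the multiple \<open>q * j\<close> by which the smaller one lies
  below it, which leaves at most \<open>(v - 1) / q\<close> pairs for each \<open>v\<close>.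
\<close>
lemma card_mod_pairs_le:
  assumes q: "0 < q"
  shows "real (card (mod_pairs q n)) \<le> real n * (real n - 1) / (2 * real q)"
proof -
  let ?I = "SIGMA v:{1..n}. {1..(v - 1) div q}"
  have "mod_pairs q n \<subseteq> (\<lambda>(v, j). {v, v - q * j}) ` ?I"
  proof
    fix e assume e: "e \<in> mod_pairs q n"
    then obtain u v where "e = {u, v}" "u mod q = v mod q" "card e = 2" "u \<in> {1..n}" "v \<in> {1..n}"
      unfolding mod_pairs_def pairs_def by auto
    then obtain a b where ab: "e = {a, b}" "a mod q = b mod q" "a < b" "1 \<le> a" "b \<le> n"
    proof (cases "u < v")
      case False
      have "u \<noteq> v" using \<open>e = {u, v}\<close> \<open>card e = 2\<close> by auto
      with False show ?thesis
        using that[of v u] \<open>e = {u, v}\<close> \<open>u mod q = v mod q\<close> \<open>u \<in> {1..n}\<close> \<open>v \<in> {1..n}\<close>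
        by (simp add: insert_commute)
    qed auto
    then have "q dvd b - a" using mod_eq_dvd_iff_nat[of a b q] by simp
    then obtain j where j: "b - a = q * j" by blast
    have "j * q \<le> b - 1" using j ab by (simp add: mult.commute)
    then have "j \<le> (b - 1) div q" using q by (simp add: less_eq_div_iff_mult_less_eq)
    moreover have "1 \<le> j" using j ab by (cases j) auto
    moreover have "a = b - q * j" using j ab by simp
    ultimately show "e \<in> (\<lambda>(v, j). {v, v - q * j}) ` ?I"
      using ab by (intro image_eqI[of _ _ "(b, j)"]) (auto simp: insert_commute)
  qed
  then have "card (mod_pairs q n) \<le> card ((\<lambda>(v, j). {v, v - q * j}) ` ?I)"
    by (intro card_mono) auto
  also have "\<dots> \<le> card ?I" by (intro card_image_le) auto
  also have "\<dots> = (\<Sum>v\<in>{1..n}. (v - 1) div q)" by simp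
  finally have "real (card (mod_pairs q n)) \<le> real (\<Sum>v\<in>{1..n}. (v - 1) div q)"
    by (simp only: of_nat_le_iff)
  also have "\<dots> = (\<Sum>v\<in>{1..n}. real ((v - 1) div q))" by simp
  also have "\<dots> \<le> (\<Sum>v\<in>{1..n}. (real v - 1) / real q)"
  proof (rule sum_mono)
    fix v assume "v \<in> {1..n}"
    then have "real (v - 1) = real v - 1" by (simp add: of_nat_diff)
    then show "real ((v - 1) div q) \<le> (real v - 1) / real q"
      using of_nat_div_le_of_nat[of "v - 1" q, where 'a = real] by simp
  qed
  also have "\<dots> = real n * (real n - 1) / (2 * real q)"
  proof -
    have "(\<Sum>v\<in>{1..n}. real v - 1) = real n * (real n - 1) / 2"
      by (induction n) (simp_all add: field_simps)
    then show ?thesis by (simp only: sum_divide_distrib[symmetric] divide_divide_eq_left)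
  qed
  finally show ?thesis .
qed

text \<open>
  Two members with the same trace on \<open>mod_pairs q n\<close> would have a difference that is properly
  coloured by residues modulo \<open>q\<close>.
\<close>
lemma card_difference_family_le:
  assumes L: "simple_graph L" and q: "0 < q" "\<not> colourable L q" and F: "difference_family L n F"
  shows "card F \<le> 2 ^ card (mod_pairs q n)"
proof -
  have fin: "finite (mod_pairs q n)" by (simp add: mod_pairs_def)
  have inj: "inj_on (\<lambda>G. edges G \<inter> mod_pairs q n) F"
  proof (rule inj_onI, rule ccontr)
    fix G G' assume G: "G \<in> F" "G' \<in> F" "G \<noteq> G'"
      and eq: "edges G \<inter> mod_pairs q n = edges G' \<inter> mod_pairs q n"
    have copy: "contains_copy (graph_sym_diff G G') L" using F G unfolding difference_family_def by blast
    have sub: "edges G \<subseteq> pairs {1..n}" "edges G' \<subseteq> pairs {1..n}"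
      using F G by (auto simp only: difference_family_def intro!: edges_graphs_on)
    have "u mod q \<noteq> v mod q" if "{u, v} \<in> edges (graph_sym_diff G G')" for u v
    proof
      assume "u mod q = v mod q"
      moreover have "{u, v} \<in> pairs {1..n}" using that sub by (auto simp: graph_sym_diff_def)
      ultimately have "{u, v} \<in> mod_pairs q n" unfolding mod_pairs_def by blast
      then show False using that eq by (auto simp: graph_sym_diff_def)
    qed
    then have "colourable L q"
      using colourable_of_contains_copy[OF L copy, of "\<lambda>x. x mod q" q] q(1) by simp
    then show False using q(2) by simp
  qed
  have "card F \<le> card (Pow (mod_pairs q n))"
    using fin by (intro card_inj_on_le[OF inj]) auto
  then show ?thesis using fin by (simp add: card_Pow)
qed

section \<open>Maximal families and the distance capacity\<close>

lemma finite_difference_families: "finite {F. difference_family L n F}"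
  by (rule finite_subset[of _ "Pow (graphs_on n)"]) (auto simp: difference_family_def graphs_on_eq)

lemma max_difference_family:
  obtains F where "difference_family L n F" "card F = max_family_size L n"
proof -
  have "{} \<in> {F. difference_family L n F}" by (simp add: difference_family_def)
  then have "Max (card ` {F. difference_family L n F}) \<in> card ` {F. difference_family L n F}"
    using finite_difference_families by (intro Max_in) blast+
  then show ?thesis using that unfolding max_family_size_def by auto
qed

lemma card_le_max_family_size: "difference_family L n F \<Longrightarrow> card F \<le> max_family_size L n"
  unfolding max_family_size_def using finite_difference_families by (intro Max_ge) auto

lemma max_family_size_pos: "0 < max_family_size L n"
proof -
  have "difference_family L n {UGraph {1..n} {}}" by (auto simp: difference_family_def graphs_on_eq)
  from card_le_max_family_size[OF this] show ?thesis by simp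
qed

text \<open>
  The Gilbert-Varshamov argument: no graph can be added to a family of maximum size, so every graph
  differs from some member by a graph without a copy of \<open>L\<close>.
\<close>
lemma max_family_size_covering:
  assumes L: "edges L \<noteq> {}" "simple_graph L"
  shows "2 ^ (n choose 2) \<le> max_family_size L n
           * card {E \<in> Pow (pairs {1..n}). \<not> contains_copy (UGraph {1..n} E) L}"
    (is "_ \<le> _ * card ?N")
proof -
  obtain F where F: "difference_family L n F" "card F = max_family_size L n"
    by (rule max_difference_family)
  have Fsub: "F \<subseteq> graphs_on n" using F by (simp add: difference_family_def)
  have finF: "finite F" using Fsub by (rule finite_subset) (simp add: graphs_on_eq)
  have "Pow (pairs {1..n}) \<subseteq> (\<lambda>(G, H). sym_diff (edges G) H) ` (F \<times> ?N)"
  proof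
    fix E assume E: "E \<in> Pow (pairs {1..n})"
    define G0 where "G0 = UGraph {1..n} E"
    have "\<exists>G\<in>F. sym_diff (edges G) E \<in> ?N"
    proof (cases "G0 \<in> F")
      case True
      have "\<not> contains_copy (UGraph {1..n} {}) L"
        using colourable_of_contains_copy[OF L(2), of "UGraph {1..n} {}" "\<lambda>_. 0" 1]
          not_colourable_below_chromatic_number[of 1 L] chromatic_number_ge_2[OF L(2,1)] by auto
      then show ?thesis using True by (intro bexI[of _ G0]) (auto simp: G0_def)
    next
      case False
      have "\<not> difference_family L n (insert G0 F)"
        using card_le_max_family_size[of L n "insert G0 F"] F(2) finF False by auto
      moreover have "insert G0 F \<subseteq> graphs_on n" using Fsub E by (simp add: graphs_on_eq G0_def)
      ultimately obtain G1 G2 where G12: "G1 \<in> insert G0 F" "G2 \<in> insert G0 F" "G1 \<noteq> G2"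
          "\<not> contains_copy (graph_sym_diff G1 G2) L"
        unfolding difference_family_def by blast
      have "graph_sym_diff G2 G1 = graph_sym_diff G1 G2" by (simp add: graph_sym_diff_def Un_commute)
      moreover have "G1 = G0 \<or> G2 = G0" using G12 F(1) unfolding difference_family_def by blast
      ultimately obtain G where G: "G \<in> F" "\<not> contains_copy (graph_sym_diff G G0) L"
        using G12 by (metis insertE)
      have "graph_sym_diff G G0 = UGraph {1..n} (sym_diff (edges G) E)"
        "edges G \<subseteq> pairs {1..n}"
        using G(1) Fsub edges_graphs_on[of G n] by (auto simp: graph_sym_diff_def G0_def graphs_on_def)
      then show ?thesis using G E by (intro bexI[of _ G]) auto
    qed
    then obtain G where G: "G \<in> F" "sym_diff (edges G) E \<in> ?N" by blast
    have "E = (\<lambda>(G, H). sym_diff (edges G) H) (G, sym_diff (edges G) E)" by auto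
    moreover have "(G, sym_diff (edges G) E) \<in> F \<times> ?N" using G by (rule SigmaI)
    ultimately show "E \<in> (\<lambda>(G, H). sym_diff (edges G) H) ` (F \<times> ?N)" by (rule image_eqI)
  qed
  then have "card (Pow (pairs {1..n})) \<le> card (F \<times> ?N)"
    using finF by (intro surj_card_le) auto
  then show ?thesis using F(2) by (simp add: card_Pow card_pairs card_cartesian_product)
qed

lemma real_choose_2: "real (n choose 2) = real n * (real n - 1) / 2"
  by (induction n) (simp_all add: numeral_2_eq_2 field_simps)

lemma distance_rate_le:
  assumes L: "simple_graph L" and q: "0 < q" "\<not> colourable L q" and n: "2 \<le> n"
  shows "distance_rate L n \<le> 1 / real q"
proof -
  obtain F where F: "difference_family L n F" "card F = max_family_size L n"
    by (rule max_difference_family)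
  have "max_family_size L n \<le> 2 ^ card (mod_pairs q n)"
    using card_difference_family_le[OF L q F(1)] F(2) by simp
  then have "real (max_family_size L n) \<le> real (2 ^ card (mod_pairs q n))" by (simp only: of_nat_le_iff)
  then have "log 2 (real (max_family_size L n)) \<le> log 2 (2 ^ card (mod_pairs q n))"
    using max_family_size_pos[of L n] by (simp del: log_pow_cancel)
  then have "log 2 (real (max_family_size L n)) \<le> real n * (real n - 1) / (2 * real q)"
    using card_mod_pairs_le[OF q(1), of n] by simp
  then have "distance_rate L n \<le> 2 / (real n * (real n - 1)) * (real n * (real n - 1) / (2 * real q))"
    unfolding distance_rate_def using n by (intro mult_left_mono) auto
  also have "\<dots> = 1 / real q"
  proof -
    have "2 / N * (N / (2 * real q)) = 1 / real q" if "N \<noteq> 0" for N :: real using that by simp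
    then show ?thesis using n by simp
  qed
  finally show ?thesis .
qed

text \<open>
  Every graph without a copy of \<open>L\<close> is free of the complete multipartite graph with
  \<open>chromatic_number L\<close> parts of size \<open>card (vertices L)\<close>. The covering inequality and the count of
  such graphs then give the bound, with \<open>k\<close> the logarithm of the constant in the count.
\<close>
lemma distance_rate_ge:
  fixes \<epsilon> :: real
  assumes L: "simple_graph L" "edges L \<noteq> {}" and \<epsilon>: "0 < \<epsilon>" and q: "chromatic_number L = Suc q"
  obtains k where "\<And>n. 2 \<le> n \<Longrightarrow>
    1 - 2 * k / (real n * (real n - 1)) - (turan_density q + \<epsilon>) * (real n / (real n - 1)) \<le> distance_rate L n"
proof -
  define t where "t = card (vertices L)"
  obtain K where K: "0 < K" and count: "\<And>V :: nat set. finite V \<Longrightarrow>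
     real (card (multipartite_free (Suc q) t V)) \<le> K * 2 powr ((turan_density q + \<epsilon>) * (real (card V))\<^sup>2 / 2)"
    using card_multipartite_free_powr_le[OF \<epsilon>, of q t] by blast
  have "1 - 2 * log 2 K / (real n * (real n - 1)) - (turan_density q + \<epsilon>) * (real n / (real n - 1))
      \<le> distance_rate L n" if n: "2 \<le> n" for n
  proof -
    let ?N = "{E \<in> Pow (pairs {1..n}). \<not> contains_copy (UGraph {1..n} E) L}"
    let ?M = "real (max_family_size L n)"
    let ?e = "(turan_density q + \<epsilon>) * (real n)\<^sup>2 / 2"
    have sub: "?N \<subseteq> multipartite_free (Suc q) t {1..n}"
    proof
      fix E assume E: "E \<in> ?N"
      have "contains_copy (UGraph {1..n} E) L" if "complete_parts (Suc q) t {1..n} E A" for A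
        using contains_copy_of_complete_parts[OF L(1) colourable_chromatic_number[OF L(1)], of E "{1..n}" A]
          E that unfolding q t_def by simp
      then show "E \<in> multipartite_free (Suc q) t {1..n}" using E unfolding multipartite_free_def by blast
    qed
    have "real (card ?N) \<le> real (card (multipartite_free (Suc q) t {1..n}))"
      using sub by (intro of_nat_mono card_mono) auto
    also have "\<dots> \<le> K * 2 powr ?e" using count[of "{1..n}"] by simp
    finally have N: "real (card ?N) \<le> K * 2 powr ?e" .
    have "real (2 ^ (n choose 2)) \<le> real (max_family_size L n * card ?N)"
      using max_family_size_covering[OF L(2,1), of n] by (simp only: of_nat_le_iff)
    then have "2 ^ (n choose 2) \<le> ?M * real (card ?N)" by simp
    also have "\<dots> \<le> ?M * (K * 2 powr ?e)" using N by (intro mult_left_mono) auto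
    finally have "(2::real) ^ (n choose 2) \<le> ?M * (K * 2 powr ?e)" .
    then have "log 2 (2 ^ (n choose 2)) \<le> log 2 (?M * (K * 2 powr ?e))"
      by (intro log_mono) auto
    also have "\<dots> = log 2 ?M + (log 2 K + ?e)"
      using K max_family_size_pos[of L n] by (simp add: log_mult)
    finally have "real n * (real n - 1) / 2 - log 2 K - ?e \<le> log 2 ?M"
      by (simp add: real_choose_2)
    then have "2 / (real n * (real n - 1)) * (real n * (real n - 1) / 2 - log 2 K - ?e) \<le> distance_rate L n"
      unfolding distance_rate_def using n by (intro mult_left_mono) auto
    moreover have "2 / (real n * (real n - 1)) * (real n * (real n - 1) / 2 - log 2 K - ?e)
        = 1 - 2 * log 2 K / (real n * (real n - 1)) - (turan_density q + \<epsilon>) * (real n / (real n - 1))"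
      using n by (simp add: divide_simps power2_eq_square)
    ultimately show ?thesis by simp
  qed
  then show ?thesis by (rule that)
qed

theorem theorem12:
  fixes L :: "'a ugraph"
  assumes "simple_graph L" and "edges L \<noteq> {}"
  shows "convergent (distance_rate L) \<and>
         distance_capacity L = 1 / (real (chromatic_number L) - 1)"
proof -
  obtain q where q: "chromatic_number L = Suc q" "0 < q"
    using chromatic_number_ge_2[OF assms] by (cases "chromatic_number L") auto
  have nc: "\<not> colourable L q" using not_colourable_below_chromatic_number[of q L] q by simp
  have "distance_rate L \<longlonglongrightarrow> 1 / real q"
  proof (rule order_tendstoI)
    fix a assume a: "a < 1 / real q"
    define \<epsilon> where "\<epsilon> = (1 / real q - a) / 2"
    have \<epsilon>: "0 < \<epsilon>" using a by (simp add: \<epsilon>_def)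
    obtain k where k: "\<And>n. 2 \<le> n \<Longrightarrow>
      1 - 2 * k / (real n * (real n - 1)) - (turan_density q + \<epsilon>) * (real n / (real n - 1)) \<le> distance_rate L n"
      using distance_rate_ge[OF assms \<epsilon> q(1)] by blast
    have "(\<lambda>n::nat. 2 * k / (real n * (real n - 1))) \<longlonglongrightarrow> 0"
      and "(\<lambda>n::nat. real n / (real n - 1)) \<longlonglongrightarrow> 1" by real_asymp+
    then have "(\<lambda>n::nat. 1 - 2 * k / (real n * (real n - 1)) - (turan_density q + \<epsilon>) * (real n / (real n - 1)))
        \<longlonglongrightarrow> 1 - 0 - (turan_density q + \<epsilon>) * 1"
      by (intro tendsto_diff tendsto_mult tendsto_const)
    moreover have "a < 1 - 0 - (turan_density q + \<epsilon>) * 1"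
      using q a by (simp add: turan_density_def \<epsilon>_def field_simps)
    ultimately have "eventually (\<lambda>n. a < 1 - 2 * k / (real n * (real n - 1))
        - (turan_density q + \<epsilon>) * (real n / (real n - 1))) sequentially"
      by (rule order_tendstoD(1))
    with eventually_ge_at_top[of 2] show "eventually (\<lambda>n. a < distance_rate L n) sequentially"
      by eventually_elim (rule less_le_trans[OF _ k], assumption+)
  next
    fix a assume "1 / real q < a"
    then show "eventually (\<lambda>n. distance_rate L n < a) sequentially"
      using distance_rate_le[OF assms(1) q(2) nc] by (intro eventually_sequentiallyI[of 2]) fastforce
  qed
  then show ?thesis
    unfolding distance_capacity_def using q by (auto simp: convergent_def limI)
qed

end
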